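(* Let $*:\hat S\to\widehat{{}^*S}$ be an enlargement, and let $p:\mathcal F\to\mathcal E$ be a fibration of $\hat S$-small categories. Then ${}^*p:{}^*\mathcal F\to{}^*\mathcal E$ is also a fibration, and for all objects $B$ of $\mathcal E$ we have ${}^*(\mathcal F_B)=({}^*\mathcal F)_{{}^*B}$.
   Context: Superstructures: a base set $S$ is an infinite set whose elements are not sets; $S_0=S$, $S_n=S_{n-1}\cup\mathcal P(S_{n-1})$, and $\hat S=\bigcup_{n\ge 0}S_n$. Formulas in $\hat S$ are built from $=$, $\in$, constants in $\hat S$, variables, ordered pairs and function application by $\neg$, $\wedge$ and bounded quantifiers $\forall x\in t$; statements are formulas without free variables. For $\varphi$ a formula in $\hat S$, ${}^*\varphi$ is obtained by replacing each constant $\tau$ by ${}^*\tau$. Enlargement: a map $*:\hat S\to\hat W$ between superstructures with (1) ${}^*S=W$; (2) ${}^*s=s$ for $s\in S$; (3) (transfer) a statement $\varphi$ in $\hat S$ is true iff ${}^*\varphi$ is true; (4) (saturation) with $\mathcal I=\bigcup_{A\in\hat S\setminus S}{}^*A$ (the internal elements), every nonempty family $\{U_i\}_{i\in I}$ of nonempty sets $U_i\in\mathcal I$ with $|I|\le|\hat S|$ and the finite intersection property has nonempty intersection. $\hat S$-small category: a category $\mathcal C=\langle M,s,t,c\rangle$ given by its set of morphisms $M\in\hat S\setminus S$, the maps $s,t:M\to M$ sending a morphism to the identity of its source resp. target, and the composition relation $c=\{\langle f,g,h\rangle: f\circ g=h\}$; objects are identified with their identity morphisms. Its enlargement is the category ${}^*\mathcal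 C=\langle{}^*M,{}^*s,{}^*t,{}^*c\rangle$. A functor $p$ (a map on morphism sets) has an enlargement ${}^*p$, a functor between the enlarged categories. For a functor $p:\mathcal F\to\mathcal E$ and an object $B$ of $\mathcal E$, the fibre $\mathcal F_B$ is the category with objects $X\in\mathcal F$ with $p(X)=B$ and morphisms $f\in\mathrm{Mor}_{\mathcal F}(X,Y)$ with $p(f)=\mathrm{id}_B$. A morphism $\alpha:X\to Y$ in $\mathcal F$ is cartesian if for all $X'\in\mathcal F$ and all $u:X'\to Y$ such that there is a factorization $p(u)=p(\alpha)\circ\beta$, there is a unique $\overline u\in\mathrm{Mor}_{\mathcal F}(X',X)$ with $u=\alpha\circ\overline u$ and $p(\overline u)=\beta$. $p$ is a fibration if for every morphism $\alpha:B'\to B$ in $\mathcal E$ and every $Y\in\mathcal F_B$ there is a cartesian morphism $f:X\to Y$ with $p(f)=\alpha$. *)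

theory Defs
  imports Main
begin

unbundle cardinal_syntax

section \<open>The ambient set theory with atoms\<close>

text \<open>
  HOL cannot construct a type large enough to contain a superstructure over an infinite set,
  so the ambient universe of sets and atoms is a type variable of the following class (second-order Zermelo set theory with atoms, without infinity). Every superstructure over
  a base set satisfies these axioms itself. All sets, ordered pairs, functions and relations that
  the superstructures talk about are elements of this universe.
\<close>

class set_universe =
  fixes is_set :: "'a \<Rightarrow> bool"
    and elts :: "'a \<Rightarrow> 'a set"
  assumes elts_atom: "\<not> is_set x \<Longrightarrow> elts x = {}"
    and extensionality: "is_set x \<Longrightarrow> is_set y \<Longrightarrow> elts x = elts y \<Longrightarrow> x = y"
    and separation: "X \<subseteq> elts a \<Longrightarrow> \<exists>b. is_set b \<and> elts b = X"
    and pairing: "\<exists>b. is_set b \<and> elts b = {x, y}"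
    and union: "\<exists>b. is_set b \<and> elts b = (\<Union>x\<in>elts a. elts x)"
    and powerset: "\<exists>b. is_set b \<and> elts b = {x. is_set x \<and> elts x \<subseteq> elts a}"

text \<open>Only meaningful if \<open>X\<close> is the extension of an element of the universe.\<close>

definition mk_set :: "'u::set_universe set \<Rightarrow> 'u" where
  "mk_set X = (THE a. is_set a \<and> elts a = X)"

definition upair :: "'u::set_universe \<Rightarrow> 'u \<Rightarrow> 'u" where
  "upair x y = mk_set {x, y}"

definition opair :: "'u::set_universe \<Rightarrow> 'u \<Rightarrow> 'u" where
  "opair x y = upair (upair x x) (upair x y)"

definition triple :: "'u::set_universe \<Rightarrow> 'u \<Rightarrow> 'u \<Rightarrow> 'u" where
  "triple x y z = opair (opair x y) z"

text \<open>
  Application is total: the value is the empty set unless \<open>f\<close> relates \<open>x\<close> to exactly one element.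
\<close>

definition app :: "'u::set_universe \<Rightarrow> 'u \<Rightarrow> 'u" where
  "app f x = (if \<exists>!y. opair x y \<in> elts f then THE y. opair x y \<in> elts f else mk_set {})"

definition is_function :: "'u::set_universe \<Rightarrow> 'u \<Rightarrow> 'u \<Rightarrow> bool" where
  "is_function f A B \<longleftrightarrow> is_set f \<and> is_set A \<and> is_set B \<and>
     (\<forall>z\<in>elts f. \<exists>x\<in>elts A. \<exists>y\<in>elts B. z = opair x y) \<and>
     (\<forall>x\<in>elts A. \<exists>!y. opair x y \<in> elts f)"

lemma mk_set_eqI: "is_set a \<Longrightarrow> elts a = X \<Longrightarrow> mk_set X = a"
  unfolding mk_set_def by (rule the_equality) (auto intro: extensionality)

lemma mk_set_subset:
  assumes "X \<subseteq> elts a"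
  shows "is_set (mk_set X)" and "elts (mk_set X) = X"
  using separation[OF assms] mk_set_eqI by metis+

lemma is_set_upair [simp]: "is_set (upair x y)"
  and elts_upair [simp]: "elts (upair x y) = {x, y}"
  using pairing[of x y] mk_set_eqI[of _ "{x, y}"] unfolding upair_def by metis+

lemma opair_eq_iff [simp]: "opair x y = opair x' y' \<longleftrightarrow> x = x' \<and> y = y'"
proof
  assume "opair x y = opair x' y'"
  then have "elts (opair x y) = elts (opair x' y')"
    by simp
  then have *: "{upair x x, upair x y} = {upair x' x', upair x' y'}"
    by (simp add: opair_def)
  then have "(\<lambda>a. elts a) ` {upair x x, upair x y} = (\<lambda>a. elts a) ` {upair x' x', upair x' y'}"
    by simp
  then have "{{x}, {x, y}} = {{x'}, {x', y'}}"
    by simp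
  then show "x = x' \<and> y = y'"
    by (auto simp: doubleton_eq_iff)
qed simp


section \<open>Superstructures\<close>

definition base_set :: "'u::set_universe \<Rightarrow> bool" where
  "base_set S \<longleftrightarrow> is_set S \<and> infinite (elts S) \<and> (\<forall>x\<in>elts S. \<not> is_set x)"

primrec level :: "'u::set_universe \<Rightarrow> nat \<Rightarrow> 'u set" where
  "level S 0 = elts S"
| "level S (Suc n) = level S n \<union> {x. is_set x \<and> elts x \<subseteq> level S n}"

definition superstructure :: "'u::set_universe \<Rightarrow> 'u set" where
  "superstructure S = (\<Union>n. level S n)"

text \<open>
  The powersets in the construction are full: every collection of elements of a level,
  in the sense of HOL, is a set of the universe, and hence an element of the next level.
\<close>

lemma level_is_set: "\<exists>a. is_set a \<and> elts a = level S n"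
proof (induction n)
  case 0
  show ?case using separation[of "elts S" S] by simp
next
  case (Suc n)
  then obtain a where a: "is_set a" "elts a = level S n" by blast
  obtain b where b: "is_set b" "elts b = {x. is_set x \<and> elts x \<subseteq> elts a}"
    using powerset by blast
  obtain c where "is_set c" "elts c = (\<Union>x\<in>elts (upair a b). elts x)"
    using union by blast
  with a b show ?case by (intro exI[of _ c]) simp
qed

lemma level_full:
  assumes "X \<subseteq> level S n"
  shows "is_set (mk_set X)" and "elts (mk_set X) = X" and "mk_set X \<in> level S (Suc n)"
  using level_is_set[of S n] mk_set_subset[of X] assms by auto


section \<open>Formulas\<close>

datatype 'u trm =
    Var nat
  | Const 'u
  | OPair "'u trm" "'u trm"
  | App "'u trm" "'u trm"

datatype 'u fm =
    Eq "'u trm" "'u trm"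
  | Mem "'u trm" "'u trm"
  | Neg "'u fm"
  | And "'u fm" "'u fm"
  | BAll nat "'u trm" "'u fm"

primrec fv_trm :: "'u trm \<Rightarrow> nat set" where
  "fv_trm (Var n) = {n}"
| "fv_trm (Const a) = {}"
| "fv_trm (OPair t u) = fv_trm t \<union> fv_trm u"
| "fv_trm (App t u) = fv_trm t \<union> fv_trm u"

primrec fv :: "'u fm \<Rightarrow> nat set" where
  "fv (Eq t u) = fv_trm t \<union> fv_trm u"
| "fv (Mem t u) = fv_trm t \<union> fv_trm u"
| "fv (Neg \<phi>) = fv \<phi>"
| "fv (And \<phi> \<psi>) = fv \<phi> \<union> fv \<psi>"
| "fv (BAll n t \<phi>) = fv_trm t \<union> (fv \<phi> - {n})"

primrec val :: "(nat \<Rightarrow> 'u::set_universe) \<Rightarrow> 'u trm \<Rightarrow> 'u" where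
  "val e (Var n) = e n"
| "val e (Const a) = a"
| "val e (OPair t u) = opair (val e t) (val e u)"
| "val e (App t u) = app (val e t) (val e u)"

primrec holds :: "(nat \<Rightarrow> 'u::set_universe) \<Rightarrow> 'u fm \<Rightarrow> bool" where
  "holds e (Eq t u) \<longleftrightarrow> val e t = val e u"
| "holds e (Mem t u) \<longleftrightarrow> val e t \<in> elts (val e u)"
| "holds e (Neg \<phi>) \<longleftrightarrow> \<not> holds e \<phi>"
| "holds e (And \<phi> \<psi>) \<longleftrightarrow> holds e \<phi> \<and> holds e \<psi>"
| "holds e (BAll n t \<phi>) \<longleftrightarrow> (\<forall>a\<in>elts (val e t). holds (e(n := a)) \<phi>)"

text \<open>The set of constants occurring in \<open>\<phi>\<close> is \<open>set_fm \<phi>\<close>.\<close>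

definition statement_in :: "'u set \<Rightarrow> 'u fm \<Rightarrow> bool" where
  "statement_in U \<phi> \<longleftrightarrow> set_fm \<phi> \<subseteq> U \<and> fv \<phi> = {}"

text \<open>For statements the truth value does not depend on the assignment.\<close>

definition is_true :: "'u::set_universe fm \<Rightarrow> bool" where
  "is_true \<phi> \<longleftrightarrow> (\<forall>e. holds e \<phi>)"


section \<open>Enlargements\<close>

definition internal :: "'u::set_universe \<Rightarrow> ('u \<Rightarrow> 'u) \<Rightarrow> 'u set" where
  "internal S star = (\<Union>A\<in>superstructure S - elts S. elts (star A))"

text \<open>
  In the saturation condition, index sets of cardinality at most that of the superstructure may be
  taken to be HOL sets of elements of the universe, as they embed into the superstructure.
\<close>

definition enlargement :: "'u::set_universe \<Rightarrow> 'u \<Rightarrow> ('u \<Rightarrow> 'u) \<Rightarrow> bool" where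
  "enlargement S W star \<longleftrightarrow>
     base_set S \<and> base_set W \<and>
     (\<forall>x\<in>superstructure S. star x \<in> superstructure W) \<and>
     star S = W \<and>
     (\<forall>s\<in>elts S. star s = s) \<and>
     (\<forall>\<phi>. statement_in (superstructure S) \<phi> \<longrightarrow> (is_true \<phi> \<longleftrightarrow> is_true (map_fm star \<phi>))) \<and>
     (\<forall>(I :: 'u set) U.
        I \<noteq> {} \<and> |I| \<le>o |superstructure S| \<and>
        (\<forall>i\<in>I. U i \<in> internal S star \<and> is_set (U i) \<and> elts (U i) \<noteq> {}) \<and>
        (\<forall>J. J \<subseteq> I \<and> finite J \<and> J \<noteq> {} \<longrightarrow> (\<Inter>i\<in>J. elts (U i)) \<noteq> {})
        \<longrightarrow> (\<Inter>i\<in>I. elts (U i)) \<noteq> {})"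


section \<open>Small categories\<close>

text \<open>
  \<open>Src\<close> and \<open>Tgt\<close> map a morphism to the identity of its source and target; \<open>triple f g h\<close> is in
  \<open>Cmp\<close> iff the composite of \<open>f\<close> after \<open>g\<close> is defined and equals \<open>h\<close>.
\<close>

record 'u cat =
  Mor :: 'u
  Src :: 'u
  Tgt :: 'u
  Cmp :: 'u

abbreviation src :: "'u::set_universe cat \<Rightarrow> 'u \<Rightarrow> 'u" where
  "src C f \<equiv> app (Src C) f"

abbreviation tgt :: "'u::set_universe cat \<Rightarrow> 'u \<Rightarrow> 'u" where
  "tgt C f \<equiv> app (Tgt C) f"

abbreviation is_comp :: "'u::set_universe cat \<Rightarrow> 'u \<Rightarrow> 'u \<Rightarrow> 'u \<Rightarrow> bool" where
  "is_comp C f g h \<equiv> triple f g h \<in> elts (Cmp C)"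

definition is_category :: "'u::set_universe cat \<Rightarrow> bool" where
  "is_category C \<longleftrightarrow>
     is_function (Src C) (Mor C) (Mor C) \<and>
     is_function (Tgt C) (Mor C) (Mor C) \<and>
     is_set (Cmp C) \<and>
     (\<forall>z\<in>elts (Cmp C). \<exists>f\<in>elts (Mor C). \<exists>g\<in>elts (Mor C). \<exists>h\<in>elts (Mor C). z = triple f g h) \<and>
     (\<forall>f\<in>elts (Mor C). src C (src C f) = src C f \<and> tgt C (src C f) = src C f \<and>
        src C (tgt C f) = tgt C f \<and> tgt C (tgt C f) = tgt C f) \<and>
     (\<forall>f\<in>elts (Mor C). \<forall>g\<in>elts (Mor C). (\<exists>h. is_comp C f g h) \<longleftrightarrow> src C f = tgt C g) \<and>
     (\<forall>f g h h'. is_comp C f g h \<and> is_comp C f g h' \<longrightarrow> h = h') \<and>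
     (\<forall>f g h. is_comp C f g h \<longrightarrow> src C h = src C g \<and> tgt C h = tgt C f) \<and>
     (\<forall>f\<in>elts (Mor C). is_comp C f (src C f) f \<and> is_comp C (tgt C f) f f) \<and>
     (\<forall>f g h fg gh k. is_comp C f g fg \<and> is_comp C g h gh \<and> is_comp C fg h k
        \<longrightarrow> is_comp C f gh k)"

definition small_category :: "'u::set_universe \<Rightarrow> 'u cat \<Rightarrow> bool" where
  "small_category S C \<longleftrightarrow> is_category C \<and> Mor C \<in> superstructure S - elts S"

text \<open>Objects are identified with their identity morphisms.\<close>

definition Obj :: "'u::set_universe cat \<Rightarrow> 'u set" where
  "Obj C = {X \<in> elts (Mor C). src C X = X}"

definition Hom :: "'u::set_universe cat \<Rightarrow> 'u \<Rightarrow> 'u \<Rightarrow> 'u set" where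
  "Hom C X Y = {f \<in> elts (Mor C). src C f = X \<and> tgt C f = Y}"

definition star_cat :: "('u \<Rightarrow> 'u) \<Rightarrow> 'u cat \<Rightarrow> 'u cat" where
  "star_cat star C =
     \<lparr>Mor = star (Mor C), Src = star (Src C), Tgt = star (Tgt C), Cmp = star (Cmp C)\<rparr>"

definition is_functor :: "'u::set_universe cat \<Rightarrow> 'u cat \<Rightarrow> 'u \<Rightarrow> bool" where
  "is_functor F E p \<longleftrightarrow>
     is_category F \<and> is_category E \<and> is_function p (Mor F) (Mor E) \<and>
     (\<forall>f\<in>elts (Mor F). app p (src F f) = src E (app p f) \<and> app p (tgt F f) = tgt E (app p f)) \<and>
     (\<forall>f g h. is_comp F f g h \<longrightarrow> is_comp E (app p f) (app p g) (app p h))"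


section \<open>Fibrations\<close>

definition fibre_mor :: "'u::set_universe cat \<Rightarrow> 'u \<Rightarrow> 'u \<Rightarrow> 'u set" where
  "fibre_mor F p B =
     {f. \<exists>X\<in>Obj F. \<exists>Y\<in>Obj F. app p X = B \<and> app p Y = B \<and> f \<in> Hom F X Y \<and> app p f = B}"

definition fibre :: "'u::set_universe cat \<Rightarrow> 'u \<Rightarrow> 'u \<Rightarrow> 'u cat" where
  "fibre F p B =
     \<lparr>Mor = mk_set (fibre_mor F p B),
      Src = mk_set {opair f (src F f) |f. f \<in> fibre_mor F p B},
      Tgt = mk_set {opair f (tgt F f) |f. f \<in> fibre_mor F p B},
      Cmp = mk_set {triple f g h |f g h. f \<in> fibre_mor F p B \<and> g \<in> fibre_mor F p B \<and>
                      h \<in> fibre_mor F p B \<and> is_comp F f g h}\<rparr>"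

definition cartesian :: "'u::set_universe cat \<Rightarrow> 'u cat \<Rightarrow> 'u \<Rightarrow> 'u \<Rightarrow> bool" where
  "cartesian F E p \<alpha> \<longleftrightarrow> \<alpha> \<in> elts (Mor F) \<and>
     (\<forall>X'\<in>Obj F. \<forall>u\<in>Hom F X' (tgt F \<alpha>). \<forall>\<beta>\<in>elts (Mor E).
        is_comp E (app p \<alpha>) \<beta> (app p u) \<longrightarrow>
        (\<exists>!v. v \<in> Hom F X' (src F \<alpha>) \<and> is_comp F \<alpha> v u \<and> app p v = \<beta>))"

definition fibration :: "'u::set_universe cat \<Rightarrow> 'u cat \<Rightarrow> 'u \<Rightarrow> bool" where
  "fibration F E p \<longleftrightarrow> is_functor F E p \<and>
     (\<forall>B'\<in>Obj E. \<forall>B\<in>Obj E. \<forall>\<alpha>\<in>Hom E B' B. \<forall>Y\<in>Obj (fibre F p B).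
        \<exists>X\<in>Obj F. \<exists>f\<in>Hom F X Y. cartesian F E p f \<and> app p f = \<alpha>)"

end

theory Submission
  imports Defs
begin

text \<open>
  Everything follows from transfer. Apart from the requirement that the data consist of sets and not
  atoms, being a category, a functor or a fibration can be said by a bounded formula whose only
  constants are the sets of morphisms, the graphs of source, target and composition, and the functor
  (\<open>is_category_iff\<close>, \<open>is_functor_iff\<close>, \<open>fibration_iff\<close>). These formulas are uniform in their
  constants, so \<open>*\<close> turns the formula for \<open>F\<close>, \<open>E\<close>, \<open>p\<close> into the same formula for \<open>*F\<close>, \<open>*E\<close>,
  \<open>*p\<close> (\<open>map_fibration_fm\<close>). Being a set is not a formula, but an element of the superstructure is a
  set iff it is not in the base set \<open>S\<close>, and transfer preserves this (\<open>star_is_set\<close>). Hence \<open>*p\<close> is a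
  fibration (\<open>fibration_star\<close>).

  For the fibres, transfer shows that \<open>*\<close> commutes with bounded comprehension (\<open>star_Collect\<close>):
  the enlargement of \<open>{x \<in> a. \<phi> x}\<close> is \<open>{x \<in> *a. *\<phi> x}\<close>. The four components of the fibre over \<open>B\<close>
  are comprehensions of this kind in the corresponding components of \<open>F\<close> (\<open>fibre_eq_Collect\<close>).
\<close>

section \<open>Bounded formulas\<close>

text \<open>The connectives and the quantifier that are not primitive in the type of formulas.\<close>

definition Imp :: "'u fm \<Rightarrow> 'u fm \<Rightarrow> 'u fm" where
  "Imp \<phi> \<psi> = Neg (And \<phi> (Neg \<psi>))"

definition Iff :: "'u fm \<Rightarrow> 'u fm \<Rightarrow> 'u fm" where
  "Iff \<phi> \<psi> = And (Imp \<phi> \<psi>) (Imp \<psi> \<phi>)"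

definition BEx :: "nat \<Rightarrow> 'u trm \<Rightarrow> 'u fm \<Rightarrow> 'u fm" where
  "BEx n t \<phi> = Neg (BAll n t (Neg \<phi>))"

lemma holds_connectives [simp]:
  "holds e (Imp \<phi> \<psi>) \<longleftrightarrow> (holds e \<phi> \<longrightarrow> holds e \<psi>)"
  "holds e (Iff \<phi> \<psi>) \<longleftrightarrow> (holds e \<phi> \<longleftrightarrow> holds e \<psi>)"
  "holds e (BEx n t \<phi>) \<longleftrightarrow> (\<exists>a\<in>elts (val e t). holds (e(n := a)) \<phi>)"
  by (auto simp: Imp_def Iff_def BEx_def)

lemma fv_connectives [simp]:
  "fv (Imp \<phi> \<psi>) = fv \<phi> \<union> fv \<psi>"
  "fv (Iff \<phi> \<psi>) = fv \<phi> \<union> fv \<psi>"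
  "fv (BEx n t \<phi>) = fv_trm t \<union> (fv \<phi> - {n})"
  by (auto simp: Imp_def Iff_def BEx_def)

lemma set_fm_connectives [simp]:
  "set_fm (Imp \<phi> \<psi>) = set_fm \<phi> \<union> set_fm \<psi>"
  "set_fm (Iff \<phi> \<psi>) = set_fm \<phi> \<union> set_fm \<psi>"
  "set_fm (BEx n t \<phi>) = set_trm t \<union> set_fm \<phi>"
  by (auto simp: Imp_def Iff_def BEx_def)

lemma map_fm_connectives [simp]:
  "map_fm g (Imp \<phi> \<psi>) = Imp (map_fm g \<phi>) (map_fm g \<psi>)"
  "map_fm g (Iff \<phi> \<psi>) = Iff (map_fm g \<phi>) (map_fm g \<psi>)"
  "map_fm g (BEx n t \<phi>) = BEx n (map_trm g t) (map_fm g \<phi>)"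
  by (auto simp: Imp_def Iff_def BEx_def)

lemma val_cong: "(\<And>n. n \<in> fv_trm t \<Longrightarrow> e n = e' n) \<Longrightarrow> val e t = val e' t"
  by (induction t) auto

lemma holds_cong: "(\<And>n. n \<in> fv \<phi> \<Longrightarrow> e n = e' n) \<Longrightarrow> holds e \<phi> \<longleftrightarrow> holds e' \<phi>"
proof (induction \<phi> arbitrary: e e')
  case (Eq t u)
  then show ?case using val_cong[of t e e'] val_cong[of u e e'] by simp
next
  case (Mem t u)
  then show ?case using val_cong[of t e e'] val_cong[of u e e'] by simp
next
  case (Neg \<phi>)
  have "holds e \<phi> = holds e' \<phi>" by (rule Neg.IH) (use Neg.prems in simp)
  then show ?case by simp
next
  case (And \<phi> \<psi>)
  have "holds e \<phi> = holds e' \<phi>" by (rule And.IH(1)) (use And.prems in simp)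
  moreover have "holds e \<psi> = holds e' \<psi>" by (rule And.IH(2)) (use And.prems in simp)
  ultimately show ?case by simp
next
  case (BAll n t \<phi>)
  have "val e t = val e' t" by (rule val_cong) (use BAll.prems in simp)
  moreover have "holds (e(n := a)) \<phi> = holds (e'(n := a)) \<phi>" for a
    by (rule BAll.IH) (use BAll.prems in auto)
  ultimately show ?case by simp
qed


section \<open>Elements of a superstructure\<close>

lemma is_set_not_atom: "base_set S \<Longrightarrow> is_set a \<Longrightarrow> a \<notin> elts S"
  by (auto simp: base_set_def)

lemma superstructure_is_set:
  assumes "a \<in> superstructure S - elts S"
  shows "is_set a"
proof -
  have "a \<in> level S n \<Longrightarrow> is_set a" for n
    by (induction n) (use assms in auto)
  then show ?thesis using assms by (auto simp: superstructure_def)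
qed

lemma level_mono: "m \<le> n \<Longrightarrow> level S m \<subseteq> level S n"
  by (induction n) (auto simp: le_Suc_eq)

lemma level_trans:
  assumes "base_set S" and "a \<in> level S n"
  shows "elts a \<subseteq> level S n"
  using assms(2)
proof (induction n)
  case 0
  then show ?case using assms(1) elts_atom by (auto simp: base_set_def)
next
  case (Suc n)
  then show ?case by auto
qed

lemma base_in_superstructure: "base_set S \<Longrightarrow> S \<in> superstructure S"
  unfolding superstructure_def base_set_def by (auto intro!: exI[of _ "Suc 0"])

lemma elts_in_superstructure:
  "base_set S \<Longrightarrow> a \<in> superstructure S \<Longrightarrow> x \<in> elts a \<Longrightarrow> x \<in> superstructure S"
  unfolding superstructure_def using level_trans by blast

lemma set_in_superstructure:
  assumes "is_set a" and "elts a \<subseteq> level S n"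
  shows "a \<in> superstructure S"
  using assms unfolding superstructure_def by (auto intro!: exI[of _ "Suc n"])

lemma subset_in_superstructure:
  assumes "base_set S" and "is_set b" and "a \<in> superstructure S" and "elts b \<subseteq> elts a"
  shows "b \<in> superstructure S"
proof -
  obtain n where "a \<in> level S n" using assms(3) by (auto simp: superstructure_def)
  then have "elts b \<subseteq> level S n" using level_trans[OF assms(1)] assms(4) by blast
  with assms(2) show ?thesis by (rule set_in_superstructure)
qed

lemma opair_in_level:
  assumes "x \<in> level S n" and "y \<in> level S n"
  shows "opair x y \<in> level S (Suc (Suc n))"
  using assms by (simp add: opair_def)

lemma common_level:
  assumes "a \<in> superstructure S" and "b \<in> superstructure S"
  obtains n where "a \<in> level S n" and "b \<in> level S n"
proof -
  from assms obtain i j where "a \<in> level S i" "b \<in> level S j"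
    by (auto simp: superstructure_def)
  then show thesis
    using that[of "max i j"] level_mono[OF max.cobounded1, of S i j]
      level_mono[OF max.cobounded2, of S j i] by blast
qed

lemma is_functionD:
  assumes "is_function f A B"
  shows "is_set f" and "\<forall>z\<in>elts f. \<exists>x\<in>elts A. \<exists>y\<in>elts B. z = opair x y"
    and "\<forall>x\<in>elts A. \<exists>!y. opair x y \<in> elts f"
  by (insert assms[unfolded is_function_def], (elim conjE, assumption)+)

lemma function_in_superstructure:
  assumes S: "base_set S" and f: "is_function f A B"
    and A: "A \<in> superstructure S" and B: "B \<in> superstructure S"
  shows "f \<in> superstructure S"
proof -
  obtain n where "A \<in> level S n" "B \<in> level S n" using A B by (rule common_level)
  then have AB: "elts A \<subseteq> level S n" "elts B \<subseteq> level S n" using level_trans[OF S] by blast+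
  have "elts f \<subseteq> level S (Suc (Suc n))"
  proof
    fix z assume "z \<in> elts f"
    then obtain x y where "x \<in> elts A" "y \<in> elts B" "z = opair x y"
      using is_functionD(2)[OF f] by blast
    then show "z \<in> level S (Suc (Suc n))" using AB opair_in_level[of x S n y] by blast
  qed
  moreover have "is_set f" using f by (rule is_functionD)
  ultimately show ?thesis using set_in_superstructure by blast
qed

lemma is_categoryD:
  assumes "is_category C"
  shows "is_function (Src C) (Mor C) (Mor C)" and "is_function (Tgt C) (Mor C) (Mor C)"
    and "is_set (Cmp C)"
    and "\<forall>z\<in>elts (Cmp C). \<exists>f\<in>elts (Mor C). \<exists>g\<in>elts (Mor C). \<exists>h\<in>elts (Mor C). z = triple f g h"
    and "\<forall>f\<in>elts (Mor C). src C (src C f) = src C f \<and> tgt C (src C f) = src C f \<and>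
        src C (tgt C f) = tgt C f \<and> tgt C (tgt C f) = tgt C f"
  by (insert assms[unfolded is_category_def], (elim conjE, assumption)+)

lemma Cmp_in_superstructure:
  assumes S: "base_set S" and C: "is_category C" and M: "Mor C \<in> superstructure S"
  shows "Cmp C \<in> superstructure S"
proof -
  obtain n where "Mor C \<in> level S n" using M by (auto simp: superstructure_def)
  then have n: "elts (Mor C) \<subseteq> level S n" using level_trans[OF S] by blast
  have "is_set (Cmp C)" using C by (rule is_categoryD)
  have "triple f g h \<in> level S (Suc (Suc (Suc (Suc n))))"
    if "f \<in> elts (Mor C)" "g \<in> elts (Mor C)" "h \<in> elts (Mor C)" for f g h
  proof -
    have "opair f g \<in> level S (Suc (Suc n))" using that n by (intro opair_in_level) auto
    moreover have "h \<in> level S (Suc (Suc n))" using that n by auto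
    ultimately show ?thesis unfolding triple_def by (rule opair_in_level)
  qed
  moreover have "\<forall>z\<in>elts (Cmp C). \<exists>f\<in>elts (Mor C). \<exists>g\<in>elts (Mor C). \<exists>h\<in>elts (Mor C). z = triple f g h"
    using C by (rule is_categoryD)
  ultimately have "elts (Cmp C) \<subseteq> level S (Suc (Suc (Suc (Suc n))))" by (metis subsetI)
  with \<open>is_set (Cmp C)\<close> show ?thesis by (rule set_in_superstructure)
qed

lemma small_category_in_superstructure:
  assumes "base_set S" and "small_category S C"
  shows "Mor C \<in> superstructure S" and "Src C \<in> superstructure S"
    and "Tgt C \<in> superstructure S" and "Cmp C \<in> superstructure S"
proof -
  have C: "is_category C" and M: "Mor C \<in> superstructure S"
    using assms(2) by (auto simp: small_category_def)
  then have "is_function (Src C) (Mor C) (Mor C)" "is_function (Tgt C) (Mor C) (Mor C)"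
    by (simp_all add: is_categoryD)
  then show "Src C \<in> superstructure S" "Tgt C \<in> superstructure S"
    using function_in_superstructure[OF assms(1) _ M M] by blast+
  show "Mor C \<in> superstructure S" "Cmp C \<in> superstructure S"
    using M Cmp_in_superstructure[OF assms(1) C M] by blast+
qed


section \<open>Transfer\<close>

lemma enlargementD:
  assumes "enlargement S W star"
  shows "base_set S" and "base_set W" and "star S = W"
    and "x \<in> superstructure S \<Longrightarrow> star x \<in> superstructure W"
  using assms by (auto simp: enlargement_def)

lemma transfer_statement:
  assumes "enlargement S W star" and "set_fm \<phi> \<subseteq> superstructure S" and "fv \<phi> = {}"
  shows "holds e (map_fm star \<phi>) \<longleftrightarrow> holds e \<phi>"
proof -
  have closed: "is_true \<psi> \<longleftrightarrow> holds e \<psi>" if "fv \<psi> = {}" for \<psi> :: "'a fm"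
    using holds_cong[of \<psi>] that unfolding is_true_def by blast
  have fv_trm: "fv_trm (map_trm star t) = fv_trm t" for t by (induction t) auto
  have "fv (map_fm star \<psi>) = fv \<psi>" for \<psi> by (induction \<psi>) (auto simp: fv_trm)
  with assms show ?thesis
    using closed[of \<phi>] closed[of "map_fm star \<phi>"]
    by (simp add: enlargement_def statement_in_def)
qed

text \<open>
  Sethood is expressed by the statement \<open>a \<notin> S\<close>, since the elements of a superstructure that are not in
  its base set are sets.
\<close>

lemma star_is_set:
  assumes E: "enlargement S W star" and a: "a \<in> superstructure S" and "is_set a"
  shows "is_set (star a)"
proof -
  note D = enlargementD[OF E]
  have "a \<notin> elts S" using D(1) assms(3) by (rule is_set_not_atom)
  moreover have "star a \<in> elts (star S) \<longleftrightarrow> a \<in> elts S"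
    using transfer_statement[OF E, of "Mem (Const a) (Const S)"] a base_in_superstructure[OF D(1)]
    by simp
  ultimately show ?thesis using superstructure_is_set[of "star a" W] D a by simp
qed

text \<open>
  The enlargement of a definable subset is defined by the transferred formula. The
  variable \<open>0\<close> stands for the element; the values of \<open>e\<close> at other variables do not matter.
\<close>

lemma star_Collect:
  assumes E: "enlargement S W star" and a: "a \<in> superstructure S" "is_set a"
    and \<phi>: "set_fm \<phi> \<subseteq> superstructure S" "fv \<phi> \<subseteq> {0}"
  shows "star (mk_set {x \<in> elts a. holds (e(0 := x)) \<phi>}) =
         mk_set {x \<in> elts (star a). holds (e(0 := x)) (map_fm star \<phi>)}" (is "star ?b = mk_set ?Y")
proof -
  note D = enlargementD[OF E]
  have b: "is_set ?b" "elts ?b = {x \<in> elts a. holds (e(0 := x)) \<phi>}"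
    by (rule mk_set_subset[of _ a], blast)+
  have b_in: "?b \<in> superstructure S"
    using subset_in_superstructure[OF D(1) b(1) a(1)] b(2) by blast
  \<comment> \<open>\<open>?b\<close> is itself an element of the superstructure, so it may occur as a constant.\<close>
  have "holds e (map_fm star (BAll 0 (Const a) (Iff (Mem (Var 0) (Const ?b)) \<phi>)))"
    by (subst transfer_statement[OF E]) (use a b b_in \<phi> in auto)
  moreover have "holds e (map_fm star (BAll 0 (Const ?b) (Mem (Var 0) (Const a))))"
    by (subst transfer_statement[OF E]) (use a b b_in in auto)
  ultimately have "elts (star ?b) = ?Y" by auto
  then show ?thesis using mk_set_eqI[of "star ?b" ?Y] star_is_set[OF E b_in b(1)] by simp
qed


section \<open>Categories, functors and fibrations as bounded formulas\<close>

text \<open>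
  \<open>f\<close> is the graph of a function from \<open>A\<close> to \<open>B\<close>. Unique existence of a value is bounded by \<open>B\<close>, which
  is correct because the first conjunct confines the values to \<open>B\<close>.
\<close>

definition function_fm :: "'u \<Rightarrow> 'u \<Rightarrow> 'u \<Rightarrow> 'u fm" where
  "function_fm f A B =
     And (BAll 0 (Const f) (BEx 1 (Const A) (BEx 2 (Const B) (Eq (Var 0) (OPair (Var 1) (Var 2))))))
         (BAll 0 (Const A) (BEx 1 (Const B) (And
            (Mem (OPair (Var 0) (Var 1)) (Const f))
            (BAll 2 (Const B) (Imp (Mem (OPair (Var 0) (Var 2)) (Const f)) (Eq (Var 2) (Var 1)))))))"

lemma is_function_iff:
  "is_function f A B \<longleftrightarrow> is_set f \<and> is_set A \<and> is_set B \<and> holds e (function_fm f A B)"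
proof (cases "\<forall>z\<in>elts f. \<exists>x\<in>elts A. \<exists>y\<in>elts B. z = opair x y")
  case True
  then have "y \<in> elts B" if "opair x y \<in> elts f" for x y using that by fastforce
  then have "(\<exists>!y. opair x y \<in> elts f) \<longleftrightarrow>
    (\<exists>y\<in>elts B. opair x y \<in> elts f \<and> (\<forall>y'\<in>elts B. opair x y' \<in> elts f \<longrightarrow> y' = y))" for x
    by blast
  with True show ?thesis by (simp add: is_function_def function_fm_def)
next
  case False
  moreover from False have "\<not> holds e (function_fm f A B)" by (simp add: function_fm_def)
  ultimately show ?thesis using is_functionD(2) by blast
qed

lemma app_function:
  assumes "is_function f A B" and "x \<in> elts A"
  shows "opair x (app f x) \<in> elts f" and "app f x \<in> elts B"
proof -
  have ex1: "\<exists>!y. opair x y \<in> elts f" using is_functionD(3)[OF assms(1)] assms(2) by (rule bspec)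
  then show *: "opair x (app f x) \<in> elts f"
    unfolding app_def using theI'[OF ex1] by simp
  obtain x' y' where "y' \<in> elts B" "opair x (app f x) = opair x' y'"
    using is_functionD(2)[OF assms(1)] * by blast
  then show "app f x \<in> elts B" by (metis opair_eq_iff)
qed

abbreviation src_tm :: "'u cat \<Rightarrow> 'u trm \<Rightarrow> 'u trm" where
  "src_tm C t \<equiv> App (Const (Src C)) t"

abbreviation tgt_tm :: "'u cat \<Rightarrow> 'u trm \<Rightarrow> 'u trm" where
  "tgt_tm C t \<equiv> App (Const (Tgt C)) t"

abbreviation comp_fm :: "'u cat \<Rightarrow> 'u trm \<Rightarrow> 'u trm \<Rightarrow> 'u trm \<Rightarrow> 'u fm" where
  "comp_fm C t u v \<equiv> Mem (OPair (OPair t u) v) (Const (Cmp C))"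

abbreviation BAll_Mor :: "'u cat \<Rightarrow> nat \<Rightarrow> 'u fm \<Rightarrow> 'u fm" where
  "BAll_Mor C n \<phi> \<equiv> BAll n (Const (Mor C)) \<phi>"

abbreviation BEx_Mor :: "'u cat \<Rightarrow> nat \<Rightarrow> 'u fm \<Rightarrow> 'u fm" where
  "BEx_Mor C n \<phi> \<equiv> BEx n (Const (Mor C)) \<phi>"

text \<open>
  The axioms of a category. The unbounded quantifiers of \<open>is_category\<close> are bounded here by the
  set of morphisms, which changes nothing because the conjunct after the ones about source and target
  confines the composition relation to morphisms.
\<close>

definition category_fm :: "'u cat \<Rightarrow> 'u fm" where
  "category_fm C =
     And (And (function_fm (Src C) (Mor C) (Mor C)) (function_fm (Tgt C) (Mor C) (Mor C)))
    (And (BAll 0 (Const (Cmp C)) (BEx_Mor C 1 (BEx_Mor C 2 (BEx_Mor C 3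
            (Eq (Var 0) (OPair (OPair (Var 1) (Var 2)) (Var 3)))))))
    (And (BAll_Mor C 0 (And
            (And (Eq (src_tm C (src_tm C (Var 0))) (src_tm C (Var 0)))
                 (Eq (tgt_tm C (src_tm C (Var 0))) (src_tm C (Var 0))))
            (And (Eq (src_tm C (tgt_tm C (Var 0))) (tgt_tm C (Var 0)))
                 (Eq (tgt_tm C (tgt_tm C (Var 0))) (tgt_tm C (Var 0))))))
    (And (BAll_Mor C 0 (BAll_Mor C 1
            (Iff (BEx_Mor C 2 (comp_fm C (Var 0) (Var 1) (Var 2)))
                 (Eq (src_tm C (Var 0)) (tgt_tm C (Var 1))))))
    (And (BAll_Mor C 0 (BAll_Mor C 1 (BAll_Mor C 2 (BAll_Mor C 3
            (Imp (And (comp_fm C (Var 0) (Var 1) (Var 2)) (comp_fm C (Var 0) (Var 1) (Var 3)))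
                 (Eq (Var 2) (Var 3)))))))
    (And (BAll_Mor C 0 (BAll_Mor C 1 (BAll_Mor C 2
            (Imp (comp_fm C (Var 0) (Var 1) (Var 2))
                 (And (Eq (src_tm C (Var 2)) (src_tm C (Var 1)))
                      (Eq (tgt_tm C (Var 2)) (tgt_tm C (Var 0))))))))
    (And (BAll_Mor C 0 (And (comp_fm C (Var 0) (src_tm C (Var 0)) (Var 0))
                            (comp_fm C (tgt_tm C (Var 0)) (Var 0) (Var 0))))
         (BAll_Mor C 0 (BAll_Mor C 1 (BAll_Mor C 2 (BAll_Mor C 3 (BAll_Mor C 4 (BAll_Mor C 5
            (Imp (And (comp_fm C (Var 0) (Var 1) (Var 3))
                 (And (comp_fm C (Var 1) (Var 2) (Var 4))
                      (comp_fm C (Var 3) (Var 2) (Var 5))))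
                 (comp_fm C (Var 0) (Var 4) (Var 5)))))))))))))))"

lemma is_category_iff:
  "is_category C \<longleftrightarrow>
     is_set (Mor C) \<and> is_set (Src C) \<and> is_set (Tgt C) \<and> is_set (Cmp C) \<and> holds e (category_fm C)"
proof (cases "\<forall>z\<in>elts (Cmp C). \<exists>f\<in>elts (Mor C). \<exists>g\<in>elts (Mor C). \<exists>h\<in>elts (Mor C). z = triple f g h")
  case True
  then have "f \<in> elts (Mor C) \<and> g \<in> elts (Mor C) \<and> h \<in> elts (Mor C)" if "is_comp C f g h" for f g h
    using that by (fastforce simp: triple_def)
  then have bounds:
    "(\<exists>h. is_comp C f g h) \<longleftrightarrow> (\<exists>h\<in>elts (Mor C). is_comp C f g h)"
    "(\<forall>f g h h'. is_comp C f g h \<and> is_comp C f g h' \<longrightarrow> h = h') \<longleftrightarrow>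
     (\<forall>f\<in>elts (Mor C). \<forall>g\<in>elts (Mor C). \<forall>h\<in>elts (Mor C). \<forall>h'\<in>elts (Mor C).
        is_comp C f g h \<and> is_comp C f g h' \<longrightarrow> h = h')"
    "(\<forall>f g h. is_comp C f g h \<longrightarrow> src C h = src C g \<and> tgt C h = tgt C f) \<longleftrightarrow>
     (\<forall>f\<in>elts (Mor C). \<forall>g\<in>elts (Mor C). \<forall>h\<in>elts (Mor C).
        is_comp C f g h \<longrightarrow> src C h = src C g \<and> tgt C h = tgt C f)"
    "(\<forall>f g h fg gh k. is_comp C f g fg \<and> is_comp C g h gh \<and> is_comp C fg h k
        \<longrightarrow> is_comp C f gh k) \<longleftrightarrow>
     (\<forall>f\<in>elts (Mor C). \<forall>g\<in>elts (Mor C). \<forall>h\<in>elts (Mor C).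
      \<forall>fg\<in>elts (Mor C). \<forall>gh\<in>elts (Mor C). \<forall>k\<in>elts (Mor C).
        is_comp C f g fg \<and> is_comp C g h gh \<and> is_comp C fg h k \<longrightarrow> is_comp C f gh k)" for f g
    by meson+
  show ?thesis
    unfolding is_category_def bounds is_function_iff[of _ _ _ e]
    by (simp add: category_fm_def triple_def) (rule iffI, (elim conjE, intro conjI; assumption)+)
next
  case False
  moreover from False have "\<not> holds e (category_fm C)"
    by (simp add: category_fm_def triple_def)
  ultimately show ?thesis using is_categoryD(4) by blast
qed

lemma category_closure:
  assumes "is_category C"
  shows "f \<in> elts (Mor C) \<Longrightarrow> src C f \<in> elts (Mor C)"
    and "f \<in> elts (Mor C) \<Longrightarrow> tgt C f \<in> elts (Mor C)"
    and "is_comp C f g h \<Longrightarrow> f \<in> elts (Mor C) \<and> g \<in> elts (Mor C) \<and> h \<in> elts (Mor C)"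
  using app_function(2)[OF is_categoryD(1)[OF assms]] app_function(2)[OF is_categoryD(2)[OF assms]]
    is_categoryD(4)[OF assms]
  by (simp_all, fastforce simp: triple_def)

lemma src_in_Obj: "is_category C \<Longrightarrow> f \<in> elts (Mor C) \<Longrightarrow> src C f \<in> Obj C"
  and tgt_in_Obj: "is_category C \<Longrightarrow> f \<in> elts (Mor C) \<Longrightarrow> tgt C f \<in> Obj C"
  using is_categoryD(5)[of C] by (auto simp: Obj_def category_closure)

lemma tgt_Obj: "is_category C \<Longrightarrow> X \<in> Obj C \<Longrightarrow> tgt C X = X"
  using is_categoryD(5)[of C] unfolding Obj_def by (metis (mono_tags, lifting) mem_Collect_eq)

text \<open>
  The axioms of a functor, including those of both categories; quantifiers over composable
  morphisms are bounded as in \<open>category_fm\<close>.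
\<close>

definition functor_fm :: "'u cat \<Rightarrow> 'u cat \<Rightarrow> 'u \<Rightarrow> 'u fm" where
  "functor_fm F E p =
     And (And (category_fm F) (category_fm E))
    (And (function_fm p (Mor F) (Mor E))
    (And (BAll_Mor F 0 (And
            (Eq (App (Const p) (src_tm F (Var 0))) (src_tm E (App (Const p) (Var 0))))
            (Eq (App (Const p) (tgt_tm F (Var 0))) (tgt_tm E (App (Const p) (Var 0))))))
         (BAll_Mor F 0 (BAll_Mor F 1 (BAll_Mor F 2
            (Imp (comp_fm F (Var 0) (Var 1) (Var 2))
                 (comp_fm E (App (Const p) (Var 0)) (App (Const p) (Var 1))
                    (App (Const p) (Var 2)))))))))"

text \<open>The part of \<open>is_category\<close> that is not a formula: all four components are sets.\<close>

definition set_cat :: "'u::set_universe cat \<Rightarrow> bool" where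
  "set_cat C \<longleftrightarrow> is_set (Mor C) \<and> is_set (Src C) \<and> is_set (Tgt C) \<and> is_set (Cmp C)"

lemma is_functor_iff:
  "is_functor F E p \<longleftrightarrow> set_cat F \<and> set_cat E \<and> is_set p \<and> holds e (functor_fm F E p)"
proof (cases "is_category F")
  case True
  have "(\<forall>f g h. is_comp F f g h \<longrightarrow> is_comp E (app p f) (app p g) (app p h)) \<longleftrightarrow>
    (\<forall>f\<in>elts (Mor F). \<forall>g\<in>elts (Mor F). \<forall>h\<in>elts (Mor F).
       is_comp F f g h \<longrightarrow> is_comp E (app p f) (app p g) (app p h))"
    using category_closure(3)[OF True] by blast
  then show ?thesis
    unfolding is_functor_def is_category_iff[of _ e] is_function_iff[of _ _ _ e] set_cat_def
    by (simp add: functor_fm_def triple_def) (rule iffI, (elim conjE, intro conjI; assumption)+)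
next
  case False
  then show ?thesis
    using is_category_iff[of F e] unfolding is_functor_def functor_fm_def set_cat_def holds.simps
    by blast
qed

text \<open>
  The morphism \<open>\<alpha> : X \<rightarrow> Y\<close> denoted by \<open>t\<close> is cartesian. The quantifiers over \<open>X'\<close> and
  \<open>u : X' \<rightarrow> Y\<close> become one quantifier over morphisms \<open>u\<close> with the target of \<open>\<alpha>\<close>. Variables \<open>3\<close> to
  \<open>6\<close> are \<open>u\<close>, \<open>\<beta>\<close>, the lift and its competitors; they must not occur in \<open>t\<close>.
\<close>

definition cartesian_fm :: "'u cat \<Rightarrow> 'u cat \<Rightarrow> 'u \<Rightarrow> 'u trm \<Rightarrow> 'u fm" where
  "cartesian_fm F E p t =
     (let lift = \<lambda>v. And (And (Eq (src_tm F v) (src_tm F (Var 3))) (Eq (tgt_tm F v) (src_tm F t)))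
                         (And (comp_fm F t v (Var 3)) (Eq (App (Const p) v) (Var 4)))
      in BAll_Mor F 3 (BAll_Mor E 4
           (Imp (And (Eq (tgt_tm F (Var 3)) (tgt_tm F t))
                     (comp_fm E (App (Const p) t) (Var 4) (App (Const p) (Var 3))))
                (BEx_Mor F 5 (And (lift (Var 5))
                   (BAll_Mor F 6 (Imp (lift (Var 6)) (Eq (Var 6) (Var 5)))))))))"

lemma cartesian_iff:
  assumes "is_category F" and "e n \<in> elts (Mor F)" and "n < 3"
  shows "cartesian F E p (e n) \<longleftrightarrow> holds e (cartesian_fm F E p (Var n))"
proof -
  have ex1: "(\<exists>!v. v \<in> Hom F X Y \<and> Q v) \<longleftrightarrow>
      (\<exists>v\<in>elts (Mor F). ((src F v = X \<and> tgt F v = Y) \<and> Q v) \<and>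
         (\<forall>w\<in>elts (Mor F). (src F w = X \<and> tgt F w = Y) \<and> Q w \<longrightarrow> w = v))" for X Y Q
    unfolding Hom_def mem_Collect_eq by blast
  have "cartesian F E p (e n) \<longleftrightarrow>
    (\<forall>u\<in>elts (Mor F). \<forall>\<beta>\<in>elts (Mor E).
       tgt F u = tgt F (e n) \<and> is_comp E (app p (e n)) \<beta> (app p u) \<longrightarrow>
       (\<exists>!v. v \<in> Hom F (src F u) (src F (e n)) \<and> is_comp F (e n) v u \<and> app p v = \<beta>))" (is "_ \<longleftrightarrow> ?R")
  proof
    assume cart: "cartesian F E p (e n)"
    show ?R
    proof (intro ballI impI)
      fix u \<beta>
      assume "u \<in> elts (Mor F)" "\<beta> \<in> elts (Mor E)"
        and "tgt F u = tgt F (e n) \<and> is_comp E (app p (e n)) \<beta> (app p u)"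
      moreover from this have "src F u \<in> Obj F" "u \<in> Hom F (src F u) (tgt F (e n))"
        using src_in_Obj[OF assms(1)] by (simp_all add: Hom_def)
      ultimately show "\<exists>!v. v \<in> Hom F (src F u) (src F (e n)) \<and> is_comp F (e n) v u \<and> app p v = \<beta>"
        using cart unfolding cartesian_def by blast
    qed
  next
    assume R: ?R
    show "cartesian F E p (e n)"
      unfolding cartesian_def
    proof (intro conjI ballI impI)
      fix X' u \<beta>
      assume "u \<in> Hom F X' (tgt F (e n))" "\<beta> \<in> elts (Mor E)" "is_comp E (app p (e n)) \<beta> (app p u)"
      moreover from this have "u \<in> elts (Mor F)" "src F u = X'" "tgt F u = tgt F (e n)"
        by (simp_all add: Hom_def)
      ultimately show "\<exists>!v. v \<in> Hom F X' (src F (e n)) \<and> is_comp F (e n) v u \<and> app p v = \<beta>"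
        using R by blast
    qed (rule assms(2))
  qed
  also have "\<dots> \<longleftrightarrow> holds e (cartesian_fm F E p (Var n))"
    using assms(3) unfolding ex1 by (simp add: cartesian_fm_def Let_def triple_def)
  finally show ?thesis .
qed

text \<open>
  \<open>B'\<close> and \<open>B\<close> are recovered as source and target of \<open>\<alpha>\<close> (variable \<open>0\<close>), and that \<open>Y\<close> (variable \<open>1\<close>) is an
  object of the fibre over \<open>B\<close> is said without the fibre: \<open>Y\<close> is an object of \<open>F\<close> with \<open>p Y = B\<close>.
  Variable \<open>2\<close> is the cartesian lift.
\<close>

definition fibration_fm :: "'u cat \<Rightarrow> 'u cat \<Rightarrow> 'u \<Rightarrow> 'u fm" where
  "fibration_fm F E p =
     And (functor_fm F E p)
       (BAll_Mor E 0 (BAll_Mor F 1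
          (Imp (And (Eq (src_tm F (Var 1)) (Var 1)) (Eq (App (Const p) (Var 1)) (tgt_tm E (Var 0))))
               (BEx_Mor F 2 (And (Eq (tgt_tm F (Var 2)) (Var 1))
                  (And (cartesian_fm F E p (Var 2)) (Eq (App (Const p) (Var 2)) (Var 0))))))))"

lemma fibre_mor_eq:
  assumes "is_category F"
  shows "fibre_mor F p B =
    {f \<in> elts (Mor F). app p (src F f) = B \<and> app p (tgt F f) = B \<and> app p f = B}"
  unfolding fibre_mor_def Hom_def using src_in_Obj[OF assms] tgt_in_Obj[OF assms] by blast

lemma Obj_fibre:
  assumes F: "is_category F"
  shows "Obj (fibre F p B) = {Y \<in> Obj F. app p Y = B}"
proof -
  let ?M = "fibre_mor F p B"
  have fn: "is_function (Src F) (Mor F) (Mor F)" using F by (rule is_categoryD)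
  have M: "?M \<subseteq> elts (Mor F)" unfolding fibre_mor_def Hom_def by blast
  have "{opair f (src F f) |f. f \<in> ?M} \<subseteq> elts (Src F)" using app_function(1)[OF fn] M by blast
  then have Src: "elts (Src (fibre F p B)) = {opair f (src F f) |f. f \<in> ?M}"
    using mk_set_subset(2) by (simp add: fibre_def)
  have "src (fibre F p B) f = src F f" if "f \<in> ?M" for f
    using that by (simp add: app_def[of "Src (fibre F p B)"] Src)
  moreover have "elts (Mor (fibre F p B)) = ?M" using mk_set_subset(2)[OF M] by (simp add: fibre_def)
  ultimately have "Obj (fibre F p B) = {Y \<in> ?M. src F Y = Y}" unfolding Obj_def by fastforce
  also have "\<dots> = {Y \<in> Obj F. app p Y = B}"
  proof (intro set_eqI iffI)
    fix Y assume "Y \<in> {Y \<in> Obj F. app p Y = B}"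
    then have "src F Y = Y" "tgt F Y = Y" "Y \<in> elts (Mor F)" "app p Y = B"
      using tgt_Obj[OF F] by (auto simp: Obj_def)
    then show "Y \<in> {Y \<in> ?M. src F Y = Y}" by (simp add: fibre_mor_eq[OF F])
  qed (simp add: fibre_mor_eq[OF F] Obj_def)
  finally show ?thesis .
qed

lemma fibration_iff:
  "fibration F E p \<longleftrightarrow> set_cat F \<and> set_cat E \<and> is_set p \<and> holds e (fibration_fm F E p)"
proof (cases "is_functor F E p")
  case True
  then have F: "is_category F" and E: "is_category E" by (auto simp: is_functor_def)
  have "fibration F E p \<longleftrightarrow>
    (\<forall>\<alpha>\<in>elts (Mor E). \<forall>Y\<in>elts (Mor F). src F Y = Y \<and> app p Y = tgt E \<alpha> \<longrightarrow>
       (\<exists>f\<in>elts (Mor F). tgt F f = Y \<and> cartesian F E p f \<and> app p f = \<alpha>))" (is "_ \<longleftrightarrow> ?R")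
  proof
    assume L: "fibration F E p"
    show ?R
    proof (intro ballI impI)
      fix \<alpha> Y assume "\<alpha> \<in> elts (Mor E)" "Y \<in> elts (Mor F)" "src F Y = Y \<and> app p Y = tgt E \<alpha>"
      then have "src E \<alpha> \<in> Obj E" "tgt E \<alpha> \<in> Obj E" "\<alpha> \<in> Hom E (src E \<alpha>) (tgt E \<alpha>)"
        "Y \<in> Obj (fibre F p (tgt E \<alpha>))"
        using src_in_Obj[OF E] tgt_in_Obj[OF E] by (auto simp: Obj_fibre[OF F] Hom_def Obj_def[of F])
      then obtain X f where "f \<in> Hom F X Y" "cartesian F E p f" "app p f = \<alpha>"
        using L unfolding fibration_def by blast
      then show "\<exists>f\<in>elts (Mor F). tgt F f = Y \<and> cartesian F E p f \<and> app p f = \<alpha>"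
        by (auto simp: Hom_def)
    qed
  next
    assume R: ?R
    have "\<exists>X\<in>Obj F. \<exists>f\<in>Hom F X Y. cartesian F E p f \<and> app p f = \<alpha>"
      if "\<alpha> \<in> Hom E B' B" "Y \<in> Obj (fibre F p B)" for B' B \<alpha> Y
    proof -
      have "Y \<in> Obj F \<and> app p Y = B" using that(2) unfolding Obj_fibre[OF F] by blast
      with that(1) have "\<alpha> \<in> elts (Mor E)" "Y \<in> elts (Mor F)" "src F Y = Y \<and> app p Y = tgt E \<alpha>"
        by (auto simp: Hom_def Obj_def)
      then obtain f where "f \<in> elts (Mor F)" "tgt F f = Y" "cartesian F E p f" "app p f = \<alpha>"
        using R by blast
      then show ?thesis
        using src_in_Obj[OF F] by (intro bexI[of _ "src F f"] bexI[of _ f]) (auto simp: Hom_def)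
    qed
    then show "fibration F E p" using True by (simp add: fibration_def)
  qed
  also have "\<dots> \<longleftrightarrow> holds e (fibration_fm F E p)"
  proof -
    have "holds (e'(2 := f)) (cartesian_fm F E p (Var 2)) \<longleftrightarrow> cartesian F E p f"
      if "f \<in> elts (Mor F)" for e' f
      using cartesian_iff[OF F, of "e'(2 := f)" 2 E p] that by simp
    moreover have "holds e (functor_fm F E p)" using True is_functor_iff by blast
    ultimately show ?thesis by (simp add: fibration_fm_def cong: bex_cong)
  qed
  finally show ?thesis using True is_functor_iff[of F E p e] by blast
next
  case False
  then show ?thesis
    using is_functor_iff[of F E p e] unfolding fibration_def fibration_fm_def holds.simps by blast
qed


section \<open>The enlargement of a fibration\<close>

lemma map_fibration_fm:
  "map_fm star (fibration_fm F E p) = fibration_fm (star_cat star F) (star_cat star E) (star p)"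
  by (simp add: fibration_fm_def functor_fm_def category_fm_def function_fm_def cartesian_fm_def
      Let_def star_cat_def)

lemma fv_fibration_fm: "fv (fibration_fm F E p) = {}"
  by (auto simp: fibration_fm_def functor_fm_def category_fm_def function_fm_def cartesian_fm_def
      Let_def)

lemma set_fibration_fm:
  "set_fm (fibration_fm F E p) \<subseteq> {Mor F, Src F, Tgt F, Cmp F, Mor E, Src E, Tgt E, Cmp E, p}"
  by (auto simp: fibration_fm_def functor_fm_def category_fm_def function_fm_def cartesian_fm_def
      Let_def)

lemma set_cat_star:
  assumes En: "enlargement S W star" and C: "small_category S C"
  shows "set_cat C" and "set_cat (star_cat star C)"
proof -
  show "set_cat C"
    using C is_category_iff[of C] unfolding small_category_def set_cat_def by blast
  then show "set_cat (star_cat star C)"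
    using small_category_in_superstructure[OF enlargementD(1)[OF En] C] star_is_set[OF En]
    by (simp add: set_cat_def star_cat_def)
qed

lemma fibration_star:
  assumes En: "enlargement S W star" and F: "small_category S F" and E: "small_category S E"
    and fib: "fibration F E p"
  shows "fibration (star_cat star F) (star_cat star E) (star p)"
proof -
  note S = enlargementD(1)[OF En]
  note in_S = small_category_in_superstructure[OF S F] small_category_in_superstructure[OF S E]
  have p: "is_function p (Mor F) (Mor E)" using fib by (simp add: fibration_def is_functor_def)
  have p_in: "p \<in> superstructure S" using S p in_S(1,5) by (rule function_in_superstructure)
  have "set_fm (fibration_fm F E p) \<subseteq> superstructure S"
    using set_fibration_fm[of F E p] in_S p_in by auto
  then have "holds e (fibration_fm (star_cat star F) (star_cat star E) (star p))" for e
    using transfer_statement[OF En _ fv_fibration_fm] fib fibration_iff[of F E p e]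
    by (simp add: map_fibration_fm)
  moreover have "is_set (star p)" using star_is_set[OF En p_in] is_functionD(1)[OF p] by simp
  ultimately show ?thesis
    using set_cat_star[OF En F] set_cat_star[OF En E] fibration_iff by blast
qed

text \<open>
  The morphism of \<open>F\<close> denoted by \<open>t\<close> belongs to the fibre over \<open>B\<close>; that its source and target are
  objects is automatic in a category.
\<close>

definition fibre_fm :: "'u cat \<Rightarrow> 'u \<Rightarrow> 'u \<Rightarrow> 'u trm \<Rightarrow> 'u fm" where
  "fibre_fm F p B t =
     And (Eq (App (Const p) (src_tm F t)) (Const B))
    (And (Eq (App (Const p) (tgt_tm F t)) (Const B)) (Eq (App (Const p) t) (Const B)))"

text \<open>
  The formulas in the variable \<open>0\<close> that cut the graphs of the fibre out of those of the category:
  \<open>r\<close> is the graph of source or target, and \<open>fibre_comp_fm\<close> is for composition.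
\<close>

definition fibre_graph_fm :: "'u cat \<Rightarrow> 'u \<Rightarrow> 'u \<Rightarrow> 'u \<Rightarrow> 'u fm" where
  "fibre_graph_fm F p B r =
     BEx_Mor F 1 (And (fibre_fm F p B (Var 1)) (Eq (Var 0) (OPair (Var 1) (App (Const r) (Var 1)))))"

definition fibre_comp_fm :: "'u cat \<Rightarrow> 'u \<Rightarrow> 'u \<Rightarrow> 'u fm" where
  "fibre_comp_fm F p B =
     BEx_Mor F 1 (BEx_Mor F 2 (BEx_Mor F 3
       (And (And (fibre_fm F p B (Var 1)) (And (fibre_fm F p B (Var 2)) (fibre_fm F p B (Var 3))))
            (Eq (Var 0) (OPair (OPair (Var 1) (Var 2)) (Var 3))))))"

lemma fibre_eq_Collect:
  assumes F: "is_category F"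
  shows "fibre F p B =
    \<lparr>Mor = mk_set {x \<in> elts (Mor F). holds (e(0 := x)) (fibre_fm F p B (Var 0))},
     Src = mk_set {x \<in> elts (Src F). holds (e(0 := x)) (fibre_graph_fm F p B (Src F))},
     Tgt = mk_set {x \<in> elts (Tgt F). holds (e(0 := x)) (fibre_graph_fm F p B (Tgt F))},
     Cmp = mk_set {x \<in> elts (Cmp F). holds (e(0 := x)) (fibre_comp_fm F p B)}\<rparr>"
proof -
  have fn: "is_function (Src F) (Mor F) (Mor F)" "is_function (Tgt F) (Mor F) (Mor F)"
    using F by (rule is_categoryD)+
  have "{opair f (app r f) |f. f \<in> fibre_mor F p B} =
    {x \<in> elts r. holds (e(0 := x)) (fibre_graph_fm F p B r)}"
    if "is_function r (Mor F) (Mor F)" for r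
    using app_function(1)[OF that]
    by (auto simp: fibre_mor_eq[OF F] fibre_graph_fm_def fibre_fm_def)
  moreover have "{triple f g h |f g h. f \<in> fibre_mor F p B \<and> g \<in> fibre_mor F p B \<and>
      h \<in> fibre_mor F p B \<and> is_comp F f g h} =
    {x \<in> elts (Cmp F). holds (e(0 := x)) (fibre_comp_fm F p B)}"
    by (auto simp: fibre_mor_eq[OF F] fibre_comp_fm_def fibre_fm_def triple_def)
  moreover have "fibre_mor F p B =
    {x \<in> elts (Mor F). holds (e(0 := x)) (fibre_fm F p B (Var 0))}"
    by (auto simp: fibre_mor_eq[OF F] fibre_fm_def)
  ultimately show ?thesis
    unfolding fibre_def using fn by simp
qed

lemma star_cat_fibre:
  assumes En: "enlargement S W star" and F: "small_category S F"
    and star_F: "is_category (star_cat star F)"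
    and p: "p \<in> superstructure S" and B: "B \<in> superstructure S"
  shows "star_cat star (fibre F p B) = fibre (star_cat star F) (star p) (star B)"
proof -
  have cat: "is_category F" using F by (simp add: small_category_def)
  note in_S = small_category_in_superstructure[OF enlargementD(1)[OF En] F] p B
  note comps = fibre_graph_fm_def fibre_comp_fm_def fibre_fm_def
  have sets: "is_set (Mor F)" "is_set (Src F)" "is_set (Tgt F)" "is_set (Cmp F)"
    using set_cat_star(1)[OF En F] by (auto simp: set_cat_def)
  have fv: "fv (fibre_fm F p B (Var 0)) \<subseteq> {0}" "fv (fibre_graph_fm F p B r) \<subseteq> {0}"
    "fv (fibre_comp_fm F p B) \<subseteq> {0}" for r
    by (auto simp: comps)
  fix e :: "nat \<Rightarrow> 'a"
  show ?thesis
    unfolding fibre_eq_Collect[OF cat, of p B e] fibre_eq_Collect[OF star_F, of "star p" "star B" e]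
    using star_Collect[OF En in_S(1) sets(1) _ fv(1), of e]
      star_Collect[OF En in_S(2) sets(2) _ fv(2)[of "Src F"], of e]
      star_Collect[OF En in_S(3) sets(3) _ fv(2)[of "Tgt F"], of e]
      star_Collect[OF En in_S(4) sets(4) _ fv(3), of e] in_S
    by (simp add: star_cat_def comps)
qed

theorem proposition7p3:
  fixes S :: "'u::set_universe" and star :: "'u \<Rightarrow> 'u"
    and F E :: "'u cat" and p :: 'u
  assumes "enlargement S (star S) star"
    and "small_category S F" and "small_category S E"
    and "fibration F E p"
  shows "fibration (star_cat star F) (star_cat star E) (star p) \<and>
         (\<forall>B\<in>Obj E. star_cat star (fibre F p B) = fibre (star_cat star F) (star p) (star B))"
proof (intro conjI ballI)
  show fib: "fibration (star_cat star F) (star_cat star E) (star p)"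
    using assms by (rule fibration_star)
  fix B assume "B \<in> Obj E"
  note S = enlargementD(1)[OF assms(1)]
  note in_S = small_category_in_superstructure(1)[OF S]
  have "B \<in> superstructure S"
    using elts_in_superstructure[OF S in_S[OF assms(3)]] \<open>B \<in> Obj E\<close> by (simp add: Obj_def)
  moreover have "p \<in> superstructure S"
    using assms(4) function_in_superstructure[OF S _ in_S[OF assms(2)] in_S[OF assms(3)]]
    by (simp add: fibration_def is_functor_def)
  ultimately show "star_cat star (fibre F p B) = fibre (star_cat star F) (star p) (star B)"
    using star_cat_fibre[OF assms(1,2)] fib by (simp add: fibration_def is_functor_def)
qed

end
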